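(* Let $A,B\in\mathbb{N}_m$ with $|A|,|B|\ge2$, and let $\underline{\alpha},\underline{\beta}\in\mathbb{Z}^+_m$. Then (i) $\underline{\alpha}A=\underline{\alpha}B$ if and only if $A=B$; (ii) $\underline{\alpha}A=\underline{\beta}A$ if and only if $\underline{\alpha}=\underline{\beta}$.
   Context: A multiset $M$ of nonnegative integers is described by its multiplicity function $\chi_M$; $|M|=\sum_n\chi_M(n)$ is its number of elements counted with multiplicity. $\mathbb{N}_m$ is the family of multisets $M$ of nonnegative integers with $\chi_M(0)=1$ and $\chi_M(n)<\infty$ for all $n\ge1$. $\mathbb{Z}^+_m$ is the set of finite vectors $\underline{\alpha}=(\alpha_1,\dots,\alpha_s)$ ($s\ge1$ arbitrary) of positive integers with $\alpha_1\le\cdots\le\alpha_s$; two such vectors are equal iff they are equal coordinatewise. For a multiset $A$ and positive integer $k$, $kA=\{ka: a\in A\}$ (with multiplicities), and the sum $A+B$ of multisets is the multiset of all $a+b$ over all pairs (with multiplicity). $\underline{\alpha}A=\alpha_1A+\alpha_2A+\cdots+\alpha_sA$; equivalently, listing $A=\{a_1\le a_2\le\cdots\}$ with multiplicity, the multiplicity of $n$ in $\underline{\alpha}A$ is $R_{A,\underline{\alpha}}(n)=|\{(j_1,\dots,j_s)\in(\mathbb{Z}^+)^s:\sum_i\alpha_ia_{j_i}=n\}|$. Equality of multisets means equality of multiplicity functions. *)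

theory Defs
  imports "HOL-Analysis.Infinite_Sum"
begin

(* A multiset of nonnegative integers is identified with its multiplicity function. Unlike
   HOL-Library.Multiset, this allows infinitely many elements and infinite multiplicities. *)
type_synonym nat_mset = "nat \<Rightarrow> enat"

definition mset_size :: "nat_mset \<Rightarrow> enat" where
  "mset_size M = (\<Sum>\<^sub>\<infinity>n. M n)"

definition N_m :: "nat_mset set" where
  "N_m = {M. M 0 = 1 \<and> (\<forall>n\<ge>1. M n < \<infinity>)}"

definition Zplus_m :: "nat list set" where
  "Zplus_m = {\<alpha>. \<alpha> \<noteq> [] \<and> (\<forall>a\<in>set \<alpha>. a \<ge> 1) \<and> sorted \<alpha>}"

(* Image multiset of A under a \<mapsto> k * a: the copies of n arise from all copies of the m with k * m = n. *)
definition mset_dilate :: "nat \<Rightarrow> nat_mset \<Rightarrow> nat_mset" where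
  "mset_dilate k A = (\<lambda>n. \<Sum>\<^sub>\<infinity>m\<in>{m. k * m = n}. A m)"

(* The multiset of all a + b, one for each pair of copies of a in A and b in B. *)
definition mset_sum :: "nat_mset \<Rightarrow> nat_mset \<Rightarrow> nat_mset" where
  "mset_sum A B = (\<lambda>n. \<Sum>i\<le>n. A i * B (n - i))"

(* The empty sum is {0}, the neutral element of mset_sum. *)
primrec lin_comb :: "nat list \<Rightarrow> nat_mset \<Rightarrow> nat_mset" where
  "lin_comb [] A = (\<lambda>n. if n = 0 then 1 else 0)"
| "lin_comb (k # ks) A = mset_sum (mset_dilate k A) (lin_comb ks A)"

end

(* In terms of generating functions A(x), the multiset \<alpha>A is the product of the series A(x^(\<alpha>_i)).
   If A and B agree below degree n and k is at most every \<alpha>_i, then the products for A and B agree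
   below degree k n, and their coefficients there differ by (the number of i with \<alpha>_i = k) times
   A_n - B_n. Part (i) is the case of the least n with A_n \<noteq> B_n. For part (ii), compare A with the
   series 1 at the least n \<ge> 1 with A_n \<noteq> 0: after cancelling a common prefix of \<alpha> and \<beta>, the smaller
   of the two heads is detected by a coefficient. *)
theory Submission
  imports Defs "HOL-Computational_Algebra.Formal_Laurent_Series"
begin

section \<open>Products of dilated power series\<close>

unbundle fps_syntax

text \<open>This is the generating function of \<open>lin_comb L M\<close> when \<open>F\<close> is
  that of \<open>M\<close>. Integer coefficients make differences and cancellation
  available.\<close>

definition dilate_prod :: "nat list \<Rightarrow> int fps \<Rightarrow> int fps" where
  "dilate_prod L F = (\<Prod>k\<leftarrow>L. fps_compose F (fps_X ^ k))"

lemma dilate_prod_Nil [simp]: "dilate_prod [] F = 1"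
  by (simp add: dilate_prod_def)

lemma dilate_prod_Cons [simp]:
  "dilate_prod (k # L) F = fps_compose F (fps_X ^ k) * dilate_prod L F"
  by (simp add: dilate_prod_def)

lemma dilate_prod_nth_0: "F $ 0 = 1 \<Longrightarrow> dilate_prod L F $ 0 = 1"
  by (induction L) auto

lemma dilate_prod_1 [simp]: "dilate_prod L 1 = 1"
  by (induction L) auto

text \<open>Convolution terms with an index of \<open>D\<close> below \<open>m\<close> vanish, so at
  degree \<open>m\<close> only one term survives. A factor with constant term 1 therefore keeps the
  leading coefficient.\<close>

lemma fps_mult_nth_lowest:
  fixes D F :: "'a::comm_ring_1 fps"
  assumes "\<forall>i<m. D $ i = 0"
  shows "\<forall>i<m. (D * F) $ i = 0" and "(D * F) $ m = D $ m * F $ 0"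
proof -
  show "\<forall>i<m. (D * F) $ i = 0"
    using assms by (auto simp: fps_mult_nth intro!: sum.neutral)
  have "(D * F) $ m = (\<Sum>i\<in>{m}. D $ i * F $ (m - i))"
    unfolding fps_mult_nth using assms by (intro sum.mono_neutral_right) auto
  then show "(D * F) $ m = D $ m * F $ 0" by simp
qed

text \<open>Induction on \<open>L\<close>: each entry equal to \<open>k\<close> contributes one copy
  of \<open>F $ n - G $ n\<close> at degree \<open>k*n\<close>, while a larger entry pushes its
  first discrepancy beyond that degree. Here \<open>k\<close> may be absent from \<open>L\<close>;
  the count is then 0.\<close>

lemma dilate_prod_diff_nth:
  assumes "F $ 0 = 1" "G $ 0 = 1" "\<forall>i<n. F $ i = G $ i" "k \<ge> 1" "\<forall>a\<in>set L. k \<le> a"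
  shows "(\<forall>i<k*n. (dilate_prod L F - dilate_prod L G) $ i = 0) \<and>
         (dilate_prod L F - dilate_prod L G) $ (k*n) = of_nat (count_list L k) * (F $ n - G $ n)"
  using assms(5)
proof (induction L)
  case Nil
  then show ?case by simp
next
  case (Cons a L)
  let ?P = "fps_compose F (fps_X ^ a)" and ?Q = "fps_compose G (fps_X ^ a)"
  let ?D = "dilate_prod L F - dilate_prod L G"
  have a: "k \<le> a" "a \<ge> 1" using Cons.prems assms(4) by auto
  have PQ: "(?P - ?Q) $ j = (if a dvd j then F $ (j div a) - G $ (j div a) else 0)" for j
    using a by (simp add: fps_nth_compose_X_power)
  have div_less: "j div a < n" if "j < k * n" for j
  proof -
    have "j < n * a" using that a(1) by (metis mult.commute mult_le_mono1 less_le_trans)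
    then show ?thesis by (simp add: less_mult_imp_div_less)
  qed
  have low: "\<forall>j<k*n. (?P - ?Q) $ j = 0"
    unfolding PQ using div_less assms(3) by auto
  have top: "(?P - ?Q) $ (k*n) = (if a = k then F $ n - G $ n else 0)"
  \<comment> \<open>For \<open>n = 0\<close> the degree is 0 whatever \<open>a\<close> is, and the
    difference vanishes because both constant terms are 1.\<close>
  proof (cases "a = k \<or> n = 0")
    case True
    then show ?thesis unfolding PQ using a assms(1,2) by auto
  next
    case False
    then have "k * n < n * a" using a by simp
    then have "k * n div a < n" by (simp add: less_mult_imp_div_less)
    then show ?thesis unfolding PQ using False assms(3) by simp
  qed
  have IH: "\<forall>i<k*n. ?D $ i = 0"
    "?D $ (k*n) = of_nat (count_list L k) * (F $ n - G $ n)"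
    using Cons by auto
  \<comment> \<open>Telescoping changes one factor at a time; the untouched factors have constant
    term 1.\<close>
  have split: "dilate_prod (a # L) F - dilate_prod (a # L) G
      = (?P - ?Q) * dilate_prod L F + ?D * ?Q"
    by (simp add: algebra_simps)
  have unit: "dilate_prod L F $ 0 = 1" "?Q $ 0 = 1"
    using assms(1,2) by (simp_all add: dilate_prod_nth_0)
  show ?case
    unfolding split fps_add_nth fps_mult_nth_lowest(2)[OF low] fps_mult_nth_lowest(2)[OF IH(1)]
      top IH(2) unit
    using fps_mult_nth_lowest(1)[OF low, THEN spec, THEN mp]
      fps_mult_nth_lowest(1)[OF IH(1), THEN spec, THEN mp]
    by (intro conjI allI impI) (simp_all only:, simp_all add: algebra_simps)
qed

text \<open>At the least degree \<open>n\<close> of disagreement, take \<open>k\<close> as the least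
  entry of \<open>L\<close>: its count is positive, so the products differ at degree
  \<open>k*n\<close>.\<close>

lemma dilate_prod_inject:
  assumes "F $ 0 = 1" "G $ 0 = 1" "L \<noteq> []" "\<forall>a\<in>set L. a \<ge> 1"
    and eq: "dilate_prod L F = dilate_prod L G"
  shows "F = G"
proof (rule ccontr)
  assume "F \<noteq> G"
  then obtain m where "F $ m \<noteq> G $ m" by (auto simp: fps_eq_iff)
  then obtain n where n: "F $ n \<noteq> G $ n" "\<forall>i<n. F $ i = G $ i"
    using exists_least_iff[of "\<lambda>n. F $ n \<noteq> G $ n"] by auto
  define k where "k = Min (set L)"
  have k: "k \<in> set L" "\<forall>a\<in>set L. k \<le> a" using assms(3) by (auto simp: k_def)
  have "of_nat (count_list L k) * (F $ n - G $ n) = 0"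
    using dilate_prod_diff_nth[OF assms(1,2) n(2) _ k(2)] k(1) assms(4) eq by simp
  then show False using n(1) k(1) by (simp add: count_list_0_iff)
qed

text \<open>Both products are compared with those of the series 1, which are again 1. At degree
  \<open>k*n\<close> the one for \<open>L\<close> has a nonzero coefficient, and the one for
  \<open>M\<close> has 0 since \<open>k\<close> does not occur in \<open>M\<close>.\<close>

lemma dilate_prod_neq:
  assumes "F $ 0 = 1" "F \<noteq> 1" "k \<ge> 1" "k \<in> set L" "\<forall>a\<in>set L. k \<le> a" "\<forall>a\<in>set M. k < a"
  shows "dilate_prod L F \<noteq> dilate_prod M F"
proof
  assume eq: "dilate_prod L F = dilate_prod M F"
  obtain m where "F $ m \<noteq> 1 $ m" using assms(2) by (auto simp: fps_eq_iff)
  then obtain n where n: "F $ n \<noteq> 1 $ n" "\<forall>i<n. F $ i = 1 $ i"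
    using exists_least_iff[of "\<lambda>n. F $ n \<noteq> 1 $ n"] by blast
  have one: "(1 :: int fps) $ 0 = 1" by simp
  have M: "\<forall>a\<in>set M. k \<le> a" "count_list M k = 0" using assms(6) by (auto simp: count_list_0_iff)
  have "of_nat (count_list L k) * (F $ n - 1 $ n) = 0"
    using dilate_prod_diff_nth[OF assms(1) one n(2) assms(3,5)]
      dilate_prod_diff_nth[OF assms(1) one n(2) assms(3) M(1)] M(2) eq by simp
  then show False using n(1) assms(4) by (simp add: count_list_0_iff)
qed

lemma dilate_prod_inject_list:
  assumes "F $ 0 = 1" "F \<noteq> 1"
    and "sorted L" "sorted M" "\<forall>a\<in>set L. a \<ge> 1" "\<forall>a\<in>set M. a \<ge> 1"
    and "dilate_prod L F = dilate_prod M F"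
  shows "L = M"
  using assms(3-)
proof (induction L arbitrary: M)
  case Nil
  show ?case
  proof (cases M)
    case (Cons b M')
    then show ?thesis using dilate_prod_neq[OF assms(1,2), of b M "[]"] Nil by auto
  qed auto
next
  case (Cons a L)
  show ?case
  proof (cases M)
    case Nil
    then show ?thesis using dilate_prod_neq[OF assms(1,2), of a "a # L" M] Cons.prems by auto
  next
    case M: (Cons b M')
    \<comment> \<open>By sortedness, the smaller of two distinct heads lies below every entry of the
      other list.\<close>
    consider "a < b" | "b < a" | "a = b" by linarith
    then show ?thesis
    proof cases
      case 1
      then have "\<forall>x\<in>set M. a < x" using Cons.prems(2) M by auto
      then show ?thesis using dilate_prod_neq[OF assms(1,2), of a "a # L" M] Cons.prems by auto
    next
      case 2
      then have "\<forall>x\<in>set (a # L). b < x" using Cons.prems(1) by auto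
      then show ?thesis using dilate_prod_neq[OF assms(1,2), of b M "a # L"] Cons.prems M by auto
    next
      case 3
      have "fps_compose F (fps_X ^ a) $ 0 = 1" using assms(1) by simp
      \<comment> \<open>A nonzero common factor cancels, as integer power series form an integral
        domain.\<close>
      then have "fps_compose F (fps_X ^ a) \<noteq> 0" by force
      then have "dilate_prod L F = dilate_prod M' F" using Cons.prems(5) M 3 by simp
      then show ?thesis using Cons M 3 by simp
    qed
  qed
qed

section \<open>From multisets to generating functions\<close>

definition gen_fun :: "nat_mset \<Rightarrow> int fps" where
  "gen_fun M = Abs_fps (\<lambda>n. int (the_enat (M n)))"

lemma gen_fun_nth [simp]: "gen_fun M $ n = int (the_enat (M n))"
  by (simp add: gen_fun_def)

text \<open>Since \<open>the_enat\<close> is unspecified at infinity, \<open>gen_fun\<close> is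
  faithful only under this condition.\<close>

definition finite_mult :: "nat_mset \<Rightarrow> bool" where
  "finite_mult M \<longleftrightarrow> (\<forall>n. M n \<noteq> \<infinity>)"

lemma finite_multE:
  assumes "finite_mult M"
  obtains m where "M = (\<lambda>n. enat (m n))"
proof
  have "\<exists>i. M n = enat i" for n
    using assms by (simp add: finite_mult_def)
  then show "M = (\<lambda>n. enat (the_enat (M n)))"
    by (metis the_enat.simps)
qed

lemma gen_fun_inject:
  assumes "finite_mult M" "finite_mult N"
  shows "gen_fun M = gen_fun N \<longleftrightarrow> M = N"
  using assms by (auto elim!: finite_multE simp: fps_eq_iff fun_eq_iff)

lemma mset_sum_enat:
  "mset_sum (\<lambda>n. enat (f n)) (\<lambda>n. enat (g n)) = (\<lambda>n. enat (\<Sum>i\<le>n. f i * g (n - i)))"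
  unfolding mset_sum_def by (simp flip: of_nat_eq_enat)

lemma
  assumes "finite_mult M" "finite_mult N"
  shows finite_mult_mset_sum: "finite_mult (mset_sum M N)"
    and gen_fun_mset_sum: "gen_fun (mset_sum M N) = gen_fun M * gen_fun N"
proof -
  obtain f g where "M = (\<lambda>n. enat (f n))" "N = (\<lambda>n. enat (g n))"
    using assms by (auto elim!: finite_multE)
  then show "finite_mult (mset_sum M N)" "gen_fun (mset_sum M N) = gen_fun M * gen_fun N"
    by (simp_all add: mset_sum_enat finite_mult_def fps_eq_iff fps_mult_nth atLeast0AtMost)
qed

lemma mset_dilate_eq:
  assumes "k \<ge> 1"
  shows "mset_dilate k M n = (if k dvd n then M (n div k) else 0)"
proof (cases "k dvd n")
  case True
  then have "{m. k * m = n} = {n div k}" using assms by auto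
  then show ?thesis using True by (simp add: mset_dilate_def)
next
  case False
  then have "{m. k * m = n} = {}" by auto
  then show ?thesis using False by (simp add: mset_dilate_def)
qed

text \<open>Finiteness is carried through the induction because the product rule
  \<open>gen_fun_mset_sum\<close> requires it of both summands.\<close>

lemma gen_fun_lin_comb:
  assumes "finite_mult M" "\<forall>a\<in>set L. a \<ge> 1"
  shows "finite_mult (lin_comb L M) \<and> gen_fun (lin_comb L M) = dilate_prod L (gen_fun M)"
  using assms(2)
proof (induction L)
  case Nil
  show ?case by (auto simp: finite_mult_def fps_eq_iff one_enat_def zero_enat_def)
next
  case (Cons a L)
  have a: "a \<ge> 1" using Cons.prems by simp
  have "finite_mult (mset_dilate a M)"
    using assms(1) a by (simp add: finite_mult_def mset_dilate_eq zero_enat_def)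
  moreover have "gen_fun (mset_dilate a M) = fps_compose (gen_fun M) (fps_X ^ a)"
    using a by (auto simp: fps_eq_iff mset_dilate_eq fps_nth_compose_X_power zero_enat_def)
  ultimately show ?case
    using Cons by (simp add: finite_mult_mset_sum gen_fun_mset_sum)
qed

lemma N_m_finite_mult: "M \<in> N_m \<Longrightarrow> finite_mult M"
  unfolding N_m_def finite_mult_def
  by (metis (mono_tags, lifting) infinity_ne_i1 less_one linorder_not_less mem_Collect_eq order_less_irrefl)

lemma N_m_gen_fun_0: "M \<in> N_m \<Longrightarrow> gen_fun M $ 0 = 1"
  by (simp add: N_m_def one_enat_def)

text \<open>The series 1 belongs to the multiset whose only element is a single 0, and this has size
  1.\<close>

lemma gen_fun_neq_1:
  assumes "M \<in> N_m" "mset_size M \<ge> 2"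
  shows "gen_fun M \<noteq> 1"
proof
  assume eq: "gen_fun M = 1"
  obtain m where m: "M = (\<lambda>n. enat (m n))"
    using N_m_finite_mult[OF assms(1)] by (rule finite_multE)
  have "m n = (if n = 0 then 1 else 0)" for n
    using arg_cong[OF eq, of "\<lambda>F. F $ n"] by (auto simp: m split: if_splits)
  then have M: "M n = (if n = 0 then 1 else 0)" for n
    by (simp add: m one_enat_def zero_enat_def)
  have "mset_size M = infsum M {0}"
    unfolding mset_size_def by (rule infsum_cong_neutral) (auto simp: M)
  then have "mset_size M = 1" by (simp add: M)
  then show False using assms(2) by (simp add: one_enat_def numeral_eq_enat)
qed

theorem theorem1p6:
  fixes A B :: nat_mset and \<alpha> \<beta> :: "nat list"
  assumes "A \<in> N_m" and "B \<in> N_m"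
    and "mset_size A \<ge> 2" and "mset_size B \<ge> 2"
    and "\<alpha> \<in> Zplus_m" and "\<beta> \<in> Zplus_m"
  shows "(lin_comb \<alpha> A = lin_comb \<alpha> B \<longleftrightarrow> A = B) \<and>
         (lin_comb \<alpha> A = lin_comb \<beta> A \<longleftrightarrow> \<alpha> = \<beta>)"
proof -
  note fin = N_m_finite_mult[OF assms(1)] N_m_finite_mult[OF assms(2)]
  note const = N_m_gen_fun_0[OF assms(1)] N_m_gen_fun_0[OF assms(2)]
  have \<alpha>: "\<alpha> \<noteq> []" "\<forall>a\<in>set \<alpha>. a \<ge> 1" "sorted \<alpha>"
    and \<beta>: "\<forall>a\<in>set \<beta>. a \<ge> 1" "sorted \<beta>"
    using assms(5,6) by (auto simp: Zplus_m_def)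
  have "A = B" if "lin_comb \<alpha> A = lin_comb \<alpha> B"
  proof -
    have "dilate_prod \<alpha> (gen_fun A) = dilate_prod \<alpha> (gen_fun B)"
      using that gen_fun_lin_comb[OF fin(1) \<alpha>(2)] gen_fun_lin_comb[OF fin(2) \<alpha>(2)] by simp
    then have "gen_fun A = gen_fun B"
      by (rule dilate_prod_inject[OF const \<alpha>(1,2)])
    then show ?thesis using gen_fun_inject fin by blast
  qed
  moreover have "\<alpha> = \<beta>" if "lin_comb \<alpha> A = lin_comb \<beta> A"
  proof -
    have "dilate_prod \<alpha> (gen_fun A) = dilate_prod \<beta> (gen_fun A)"
      using that gen_fun_lin_comb[OF fin(1) \<alpha>(2)] gen_fun_lin_comb[OF fin(1) \<beta>(1)] by simp
    then show ?thesis
      by (rule dilate_prod_inject_list[OF const(1) gen_fun_neq_1[OF assms(1,3)] \<alpha>(3) \<beta>(2) \<alpha>(2) \<beta>(1)])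
  qed
  ultimately show ?thesis by blast
qed

end
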